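(* Let $L\ge 1$ be an integer, let $0<r,\ell<\infty$, $q=\sqrt{r/\ell}$, and consider the two-component exclusion process on $\Lambda=\{-L+1,\dots,L\}$ with state space $\mathbb{S}^{2L}$. Define, for $\boldsymbol{\eta}\in\mathbb{S}^{2L}$, $$\pi(\boldsymbol{\eta}) = q^{\,\sum_{k=-L+1}^{L}(2k-1)(a_k-b_k)+\sum_{k=-L+1}^{L-1}\sum_{l=-L+1}^{k}\left(a_l b_{k+1}-b_l a_{k+1}\right)} .$$ Then $\pi$ is a reversible measure for the process, and for all integers $N,M\ge 0$ with $N+M\le 2L$ the process restricted to the subset $\mathbb{S}^{2L}_{N,M}$ has the unique invariant (probability) measure $$\pi^\ast_{N,M}(\boldsymbol{\eta}) = \frac{\mathbf{1}_{\mathbb{S}^{2L}_{N,M}}(\boldsymbol{\eta})}{Z_{2L}(N,M)}\,\pi(\boldsymbol{\eta}),$$ with the normalization factor $$Z_{2L}(N,M)=C_{2L}(N,M).$$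
   Context: Configurations: $\mathbb{S}=\{0,1,2\}$; a configuration is $\boldsymbol{\eta}=\{\eta(-L+1),\dots,\eta(L)\}\in\mathbb{S}^{2L}$, where $\eta(k)=0$ means that site $k\in\Lambda$ is occupied by a particle of type $A$, $\eta(k)=1$ that it is vacant, and $\eta(k)=2$ that it is occupied by a particle of type $B$. Local occupation variables: $a_k=\delta_{\eta(k),0}$, $v_k=\delta_{\eta(k),1}$, $b_k=\delta_{\eta(k),2}$ (the argument $\boldsymbol{\eta}$ is suppressed). $\mathbb{S}^{2L}_{N,M}$ is the set of configurations with $\sum_k a_k=N$ and $\sum_k b_k=M$; $\mathbf{1}_A$ is the indicator function of a set $A$. Process (two-component ASEP): for $-L+1\le k\le L-1$, $\boldsymbol{\eta}^{kk+1}$ is the configuration obtained from $\boldsymbol{\eta}$ by interchanging $\eta(k)$ and $\eta(k+1)$. The process is the continuous-time Markov chain on $\mathbb{S}^{2L}$ with generator $$\mathcal{L}f(\boldsymbol{\eta})=\sum_{k=-L+1}^{L-1}w^{kk+1}(\boldsymbol{\eta})\,[f(\boldsymbol{\eta}^{kk+1})-f(\boldsymbol{\eta})],$$ $$w^{kk+1}(\boldsymbol{\eta})=r\,(a_kv_{k+1}+v_kb_{k+1}+a_kb_{k+1})+\ell\,(v_ka_{k+1}+b_kv_{k+1}+b_ka_{k+1}),$$ so the transition rates are $w(\boldsymbol{\eta}\to\boldsymbol{\eta}')=\sum_{k=-L+1}^{L-1}w^{kk+1}(\boldsymbol{\eta})\,\delta_{\boldsymbol{\eta}',\boldsymbol{\eta}^{kk+1}}$.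 The process conserves the numbers of $A$- and $B$-particles. A (possibly unnormalized) measure $\pi$ is reversible if $\pi(\boldsymbol{\eta})\,w(\boldsymbol{\eta}\to\boldsymbol{\eta}')=\pi(\boldsymbol{\eta}')\,w(\boldsymbol{\eta}'\to\boldsymbol{\eta})$ for all $\boldsymbol{\eta}\ne\boldsymbol{\eta}'$. $q$-numbers: $[x]_q=\frac{q^x-q^{-x}}{q-q^{-1}}$ (with $[x]_1:=x$), $[0]_q!=1$, $[n]_q!=\prod_{k=1}^n[k]_q$ for $n\ge1$, and $C_K(N,M)=\frac{[K]_q!}{[N]_q!\,[M]_q!\,[K-N-M]_q!}$. *)

theory Defs
  imports "HOL-Probability.Probability"
begin

subsection \<open>Configurations\<close>

definition sites :: "nat \<Rightarrow> int set" where
  "sites L = {- int L + 1 .. int L}"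

definition bonds :: "nat \<Rightarrow> int set" where
  "bonds L = {- int L + 1 .. int L - 1}"

text \<open>Local state 0: particle of type A; 1: vacant; 2: particle of type B.
  Configurations are extensional functions, i.e. \<open>undefined\<close> off the lattice, so that they
  correspond one-to-one to points of the product space.\<close>

type_synonym config = "int \<Rightarrow> nat"

definition configs :: "nat \<Rightarrow> config set" where
  "configs L = (\<Pi>\<^sub>E k \<in> sites L. {0, 1, 2})"

definition occ_A :: "config \<Rightarrow> int \<Rightarrow> int" where
  "occ_A \<eta> k = of_bool (\<eta> k = 0)"

definition occ_V :: "config \<Rightarrow> int \<Rightarrow> int" where
  "occ_V \<eta> k = of_bool (\<eta> k = 1)"

definition occ_B :: "config \<Rightarrow> int \<Rightarrow> int" where
  "occ_B \<eta> k = of_bool (\<eta> k = 2)"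

definition configs_NM :: "nat \<Rightarrow> nat \<Rightarrow> nat \<Rightarrow> config set" where
  "configs_NM L N M = {\<eta> \<in> configs L.
     (\<Sum>k \<in> sites L. occ_A \<eta> k) = int N \<and> (\<Sum>k \<in> sites L. occ_B \<eta> k) = int M}"

definition swap :: "int \<Rightarrow> config \<Rightarrow> config" where
  "swap k \<eta> = \<eta> \<circ> Transposition.transpose k (k + 1)"


subsection \<open>The two-component ASEP\<close>

definition bond_rate :: "real \<Rightarrow> real \<Rightarrow> int \<Rightarrow> config \<Rightarrow> real" where
  "bond_rate r l k \<eta> =
     r * of_int (occ_A \<eta> k * occ_V \<eta> (k + 1) + occ_V \<eta> k * occ_B \<eta> (k + 1)
                 + occ_A \<eta> k * occ_B \<eta> (k + 1))
   + l * of_int (occ_V \<eta> k * occ_A \<eta> (k + 1) + occ_B \<eta> k * occ_V \<eta> (k + 1)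
                 + occ_B \<eta> k * occ_A \<eta> (k + 1))"

definition gen :: "nat \<Rightarrow> real \<Rightarrow> real \<Rightarrow> (config \<Rightarrow> real) \<Rightarrow> config \<Rightarrow> real" where
  "gen L r l f \<eta> = (\<Sum>k \<in> bonds L. bond_rate r l k \<eta> * (f (swap k \<eta>) - f \<eta>))"

definition trans_rate :: "nat \<Rightarrow> real \<Rightarrow> real \<Rightarrow> config \<Rightarrow> config \<Rightarrow> real" where
  "trans_rate L r l \<eta> \<eta>' = (\<Sum>k \<in> bonds L. bond_rate r l k \<eta> * of_bool (\<eta>' = swap k \<eta>))"

text \<open>The Markov semigroup \<open>P\<^sub>t = exp (t \<L>)\<close> of the chain: \<open>semigroup L r l t f \<eta>\<close> is the expected
  value of \<open>f\<close> at time \<open>t\<close> for the process started from \<open>\<eta>\<close>. The state space is finite, so the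
  exponential series converges (lemma \<open>summable_semigroup\<close> below).\<close>

definition semigroup ::
  "nat \<Rightarrow> real \<Rightarrow> real \<Rightarrow> real \<Rightarrow> (config \<Rightarrow> real) \<Rightarrow> config \<Rightarrow> real" where
  "semigroup L r l t f \<eta> = (\<Sum>n. t ^ n / fact n * (gen L r l ^^ n) f \<eta>)"

definition reversible :: "nat \<Rightarrow> real \<Rightarrow> real \<Rightarrow> (config \<Rightarrow> real) \<Rightarrow> bool" where
  "reversible L r l \<mu> \<longleftrightarrow>
     (\<forall>\<eta> \<in> configs L. 0 \<le> \<mu> \<eta>) \<and>
     (\<forall>\<eta> \<in> configs L. \<forall>\<eta>' \<in> configs L. \<eta> \<noteq> \<eta>' \<longrightarrow>
        \<mu> \<eta> * trans_rate L r l \<eta> \<eta>' = \<mu> \<eta>' * trans_rate L r l \<eta>' \<eta>)"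

text \<open>Invariant probability measures of the process restricted to a set \<open>S\<close> of configurations that is
  closed under the dynamics; for \<open>S = configs_NM L N M\<close> closedness is lemma \<open>swap_configs_NM\<close>.
  For \<open>\<eta> \<in> S\<close> the value \<open>semigroup L r l t f \<eta>\<close> depends only on the restriction of \<open>f\<close> to \<open>S\<close>.\<close>

definition invariant_pmf_on ::
  "nat \<Rightarrow> real \<Rightarrow> real \<Rightarrow> config set \<Rightarrow> config pmf \<Rightarrow> bool" where
  "invariant_pmf_on L r l S \<mu> \<longleftrightarrow>
     set_pmf \<mu> \<subseteq> S \<and>
     (\<forall>t \<ge> 0. \<forall>f. measure_pmf.expectation \<mu> (semigroup L r l t f) = measure_pmf.expectation \<mu> f)"


subsection \<open>\<open>q\<close>-numbers\<close>

definition q_num :: "real \<Rightarrow> real \<Rightarrow> real" where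
  "q_num q x = (if q = 1 then x else (q powr x - q powr (- x)) / (q - inverse q))"

definition q_fact :: "real \<Rightarrow> nat \<Rightarrow> real" where
  "q_fact q n = (\<Prod>k = 1..n. q_num q (real k))"

definition q_trinomial :: "real \<Rightarrow> nat \<Rightarrow> nat \<Rightarrow> nat \<Rightarrow> real" where
  "q_trinomial q K N M = q_fact q K / (q_fact q N * q_fact q M * q_fact q (K - N - M))"


subsection \<open>The measures\<close>

definition weight :: "nat \<Rightarrow> real \<Rightarrow> config \<Rightarrow> real" where
  "weight L q \<eta> = q powi
     ((\<Sum>k \<in> sites L. (2 * k - 1) * (occ_A \<eta> k - occ_B \<eta> k))
      + (\<Sum>k \<in> bonds L. \<Sum>m = - int L + 1..k.
           occ_A \<eta> m * occ_B \<eta> (k + 1) - occ_B \<eta> m * occ_A \<eta> (k + 1)))"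

definition norm_factor :: "nat \<Rightarrow> real \<Rightarrow> nat \<Rightarrow> nat \<Rightarrow> real" where
  "norm_factor L q N M = (\<Sum>\<eta> \<in> configs_NM L N M. weight L q \<eta>)"

definition norm_weight :: "nat \<Rightarrow> real \<Rightarrow> nat \<Rightarrow> nat \<Rightarrow> config \<Rightarrow> real" where
  "norm_weight L q N M \<eta> =
     indicator (configs_NM L N M) \<eta> / norm_factor L q N M * weight L q \<eta>"


subsection \<open>Well-definedness of the process and of its restrictions\<close>

lemma finite_configs: "finite (configs L)"
  by (auto simp: configs_def sites_def intro!: finite_PiE)

lemma transpose_permutes_sites:
  assumes "k \<in> bonds L"
  shows "Transposition.transpose k (k + 1) permutes sites L"
  using assms by (intro permutes_swap_id) (auto simp: bonds_def sites_def)

lemma swap_configs: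
  assumes "k \<in> bonds L" "\<eta> \<in> configs L"
  shows "swap k \<eta> \<in> configs L"
proof -
  have p: "Transposition.transpose k (k + 1) permutes sites L"
    using assms(1) by (rule transpose_permutes_sites)
  show ?thesis
    unfolding configs_def swap_def
  proof (rule PiE_I)
    fix x assume "x \<in> sites L"
    then have "Transposition.transpose k (k + 1) x \<in> sites L" using permutes_in_image[OF p] by blast
    then show "(\<eta> \<circ> Transposition.transpose k (k + 1)) x \<in> {0, 1, 2}"
      using assms(2) PiE_mem unfolding configs_def by fastforce
  next
    fix x assume "x \<notin> sites L"
    then show "(\<eta> \<circ> Transposition.transpose k (k + 1)) x = undefined"
      using assms(2) permutes_not_in[OF p] PiE_arb unfolding configs_def by fastforce
  qed
qed

lemma swap_configs_NM:
  assumes "k \<in> bonds L" "\<eta> \<in> configs_NM L N M"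
  shows "swap k \<eta> \<in> configs_NM L N M"
proof -
  have p: "Transposition.transpose k (k + 1) permutes sites L"
    using assms(1) by (rule transpose_permutes_sites)
  have "(\<Sum>j \<in> sites L. g (swap k \<eta> j)) = (\<Sum>j \<in> sites L. g (\<eta> j))" for g :: "nat \<Rightarrow> int"
    using sum.permute[OF p, of "g \<circ> \<eta>"] by (simp add: swap_def o_def)
  from this[of "\<lambda>i. of_bool (i = 0)"] this[of "\<lambda>i. of_bool (i = 2)"] show ?thesis
    using assms swap_configs[OF assms(1)]
    unfolding configs_NM_def occ_A_def occ_B_def by simp
qed

lemma summable_semigroup:
  assumes "\<eta> \<in> configs L"
  shows "summable (\<lambda>n. t ^ n / fact n * (gen L r l ^^ n) f \<eta>)"
proof -
  define c where "c = Max ((\<lambda>\<zeta>. \<Sum>k \<in> bonds L. \<bar>bond_rate r l k \<zeta>\<bar> * 2) ` configs L)"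
  define B where "B = Max ((\<lambda>\<zeta>. \<bar>f \<zeta>\<bar>) ` configs L)"
  have c: "(\<Sum>k \<in> bonds L. \<bar>bond_rate r l k \<zeta>\<bar> * 2) \<le> c" if "\<zeta> \<in> configs L" for \<zeta>
    unfolding c_def using that finite_configs by (intro Max_ge) auto
  have B: "\<bar>f \<zeta>\<bar> \<le> B" if "\<zeta> \<in> configs L" for \<zeta>
    unfolding B_def using that finite_configs by (intro Max_ge) auto
  have "0 \<le> (\<Sum>k \<in> bonds L. \<bar>bond_rate r l k \<eta>\<bar> * 2)" by (intro sum_nonneg) auto
  with c[OF assms] have c0: "0 \<le> c" by linarith
  have B0: "0 \<le> B" using B[OF assms] by linarith
  have bound: "\<forall>\<zeta> \<in> configs L. \<bar>(gen L r l ^^ n) f \<zeta>\<bar> \<le> c ^ n * B" for n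
  proof (induction n)
    case 0
    then show ?case using B by simp
  next
    case (Suc n)
    show ?case
    proof
      fix \<zeta> assume z: "\<zeta> \<in> configs L"
      let ?g = "(gen L r l ^^ n) f"
      have "\<bar>gen L r l ?g \<zeta>\<bar> \<le> (\<Sum>k \<in> bonds L. \<bar>bond_rate r l k \<zeta> * (?g (swap k \<zeta>) - ?g \<zeta>)\<bar>)"
        unfolding gen_def by (rule sum_abs)
      also have "\<dots> \<le> (\<Sum>k \<in> bonds L. \<bar>bond_rate r l k \<zeta>\<bar> * 2 * (c ^ n * B))"
      proof (rule sum_mono)
        fix k assume "k \<in> bonds L"
        then have "\<bar>?g (swap k \<zeta>)\<bar> \<le> c ^ n * B" "\<bar>?g \<zeta>\<bar> \<le> c ^ n * B"
          using Suc.IH z swap_configs by blast+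
        then have "\<bar>?g (swap k \<zeta>) - ?g \<zeta>\<bar> \<le> 2 * (c ^ n * B)" by linarith
        then show "\<bar>bond_rate r l k \<zeta> * (?g (swap k \<zeta>) - ?g \<zeta>)\<bar>
            \<le> \<bar>bond_rate r l k \<zeta>\<bar> * 2 * (c ^ n * B)"
          by (metis abs_ge_zero abs_mult mult.assoc mult_left_mono)
      qed
      also have "\<dots> = (\<Sum>k \<in> bonds L. \<bar>bond_rate r l k \<zeta>\<bar> * 2) * (c ^ n * B)"
        by (rule sum_distrib_right[symmetric])
      also have "\<dots> \<le> c * (c ^ n * B)"
        using c[OF z] c0 B0 by (intro mult_right_mono) auto
      finally show "\<bar>(gen L r l ^^ Suc n) f \<zeta>\<bar> \<le> c ^ Suc n * B" by (simp add: mult.assoc)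
    qed
  qed
  show ?thesis
  proof (rule summable_comparison_test')
    show "summable (\<lambda>n. inverse (fact n) * (\<bar>t\<bar> * c) ^ n * B)"
      by (intro summable_mult2 summable_exp)
    fix n
    have "\<bar>t ^ n / fact n * (gen L r l ^^ n) f \<eta>\<bar> \<le> \<bar>t\<bar> ^ n / fact n * (c ^ n * B)"
      using bound[of n] assms
      by (simp add: abs_mult power_abs divide_right_mono mult_left_mono)
    then show "norm (t ^ n / fact n * (gen L r l ^^ n) f \<eta>) \<le> inverse (fact n) * (\<bar>t\<bar> * c) ^ n * B"
      by (simp add: power_mult_distrib field_simps)
  qed
qed

end

theory Submission
  imports Defs
begin

text \<open>
  Reversibility is a local matter. Interchanging the states of neighbouring sites \<open>k\<close> and \<open>k + 1\<close>
  changes the linear part of the exponent of the weight through the two sites alone, and its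
  quadratic part through the single pair \<open>(k, k + 1)\<close>, the only pair whose order is reversed. A move
  at rate \<open>r\<close> raises the exponent by exactly 2 (for \<open>A B\<close> becoming \<open>B A\<close> the linear part gives 4
  and the quadratic part -2), and \<open>q\<^sup>2 = r / l\<close>. So detailed balance already holds bond by bond
  (\<open>bond_detailed_balance\<close>).

  For invariant measures the argument is variational. By comparing Taylor coefficients at time 0,
  \<open>\<mu>\<close> is invariant for the semigroup iff every function in the image of the generator has
  \<open>\<mu>\<close>-mean zero (\<open>invariant_pmf_on_iff_gen\<close>). Write \<open>\<mu> = w h\<close> with \<open>w\<close> the reversible weight. Detailed
  balance turns the \<open>w\<close>-sum of \<open>f\<close> times \<open>gen g\<close> into minus the Dirichlet form of \<open>f\<close> and \<open>g\<close>
  (\<open>sum_gen_eq_Dirichlet_form\<close>). With \<open>f = 1\<close> this shows that \<open>w\<close> is invariant. If \<open>\<mu>\<close> is invariant,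
  then \<open>f = g = h\<close> shows that \<open>h\<close> has Dirichlet energy zero, so \<open>h\<close> does not change under any
  adjacent interchange. Adjacent interchanges generate all permutations of the sites, and two
  configurations with the same particle numbers differ by a permutation; hence \<open>h\<close> is constant on
  the sector, and the total mass 1 fixes the constant.

  The partition function is computed by adding sites at the right end. Conditioning on the state
  of the last site gives a three-term recursion (\<open>partition_sum_Suc\<close>), which the \<open>q\<close>-trinomial
  coefficient satisfies, up to a power of \<open>q\<close>, because of the addition formula \<open>q_num_add3\<close>. On the
  symmetric lattice that power is 1.
\<close>

section \<open>The exponent of the weight and detailed balance\<close>

definition charge :: "nat \<Rightarrow> int" where
  "charge x = of_bool (x = 0) - of_bool (x = 2)"

definition cross :: "nat \<Rightarrow> nat \<Rightarrow> int" where
  "cross x y = of_bool (x = 0 \<and> y = 2) - of_bool (x = 2 \<and> y = 0)"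

text \<open>The exponent on a segment with a free left end \<open>c + 1\<close> and any length \<open>K\<close>: a lattice that is
  symmetric about 1/2 cannot be grown one site at a time, whereas such a segment can. Each site is
  charged with its interactions with the sites to its left.\<close>

definition energy :: "int \<Rightarrow> nat \<Rightarrow> config \<Rightarrow> int" where
  "energy c K \<eta> = (\<Sum>j \<in> {c + 1..c + int K}.
     (2 * j - 1) * charge (\<eta> j) + (\<Sum>m \<in> {c + 1..<j}. cross (\<eta> m) (\<eta> j)))"

lemma sites_eq_segment: "sites L = {- int L + 1..- int L + int (2 * L)}"
  by (simp add: sites_def)

lemma weight_eq_energy: "weight L q \<eta> = q powi energy (- int L) (2 * L) \<eta>"
proof -
  let ?G = "\<lambda>j. \<Sum>m \<in> {- int L + 1..<j}. cross (\<eta> m) (\<eta> j)"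
  have "(\<Sum>k \<in> bonds L. \<Sum>m = - int L + 1..k.
           occ_A \<eta> m * occ_B \<eta> (k + 1) - occ_B \<eta> m * occ_A \<eta> (k + 1))
      = (\<Sum>k \<in> bonds L. ?G (k + 1))"
  proof (rule sum.cong)
    fix k
    have "{- int L + 1..k} = {- int L + 1..<k + 1}" by auto
    then show "(\<Sum>m = - int L + 1..k.
           occ_A \<eta> m * occ_B \<eta> (k + 1) - occ_B \<eta> m * occ_A \<eta> (k + 1)) = ?G (k + 1)"
      by (simp add: cross_def occ_A_def occ_B_def of_bool_conj)
  qed simp
  also have "\<dots> = (\<Sum>j \<in> {- int L + 2..int L}. ?G j)"
    by (rule sum.reindex_bij_witness[of _ "\<lambda>j. j - 1" "\<lambda>k. k + 1"]) (auto simp: bonds_def)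
  also have "\<dots> = (\<Sum>j \<in> sites L. ?G j)"
    by (rule sum.mono_neutral_left) (auto simp: sites_def intro!: sum.neutral)
  finally show ?thesis
    unfolding weight_def energy_def sites_eq_segment
    by (simp add: sum.distrib charge_def occ_A_def occ_B_def)
qed

text \<open>An adjacent interchange reverses the order of exactly one pair of lattice points, namely the
  interchanged ones, so all other ordered pairs contribute the same before and after.\<close>

lemma pair_sum_adjacent_transpose:
  fixes h :: "nat \<Rightarrow> nat \<Rightarrow> int"
  assumes "a \<le> k" "k + 1 \<le> b"
  shows "(\<Sum>j \<in> {a..b}. \<Sum>m \<in> {a..<j}. h (swap k \<eta> m) (swap k \<eta> j))
    = (\<Sum>j \<in> {a..b}. \<Sum>m \<in> {a..<j}. h (\<eta> m) (\<eta> j))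
      - h (\<eta> k) (\<eta> (k + 1)) + h (\<eta> (k + 1)) (\<eta> k)"
proof -
  define P where "P = (SIGMA j:{a..b}. {a..<j})"
  have fin: "finite P" and mem: "(k + 1, k) \<in> P"
    using assms by (auto simp: P_def)
  have P: "(\<Sum>j \<in> {a..b}. \<Sum>m \<in> {a..<j}. h (\<zeta> m) (\<zeta> j)) = (\<Sum>(j, m) \<in> P. h (\<zeta> m) (\<zeta> j))"
    for \<zeta> :: config
    unfolding P_def by (rule sum.Sigma) auto
  let ?t = "Transposition.transpose k (k + 1)"
  have "(\<Sum>(j, m) \<in> P - {(k + 1, k)}. h (swap k \<eta> m) (swap k \<eta> j))
      = (\<Sum>(j, m) \<in> P - {(k + 1, k)}. h (\<eta> m) (\<eta> j))"
    by (rule sum.reindex_bij_witness[of _ "map_prod ?t ?t" "map_prod ?t ?t"])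
      (use assms in \<open>auto simp: P_def swap_def Transposition.transpose_def split: if_splits\<close>)
  then show ?thesis
    unfolding P
    by (simp add: sum.remove[OF fin mem] swap_def)
qed

text \<open>The factor 2 of the last term arises because \<open>cross\<close> is antisymmetric: reversing one pair
  flips the sign of its contribution.\<close>

lemma energy_swap:
  assumes k: "k \<in> {c + 1..<c + int K}"
  shows "energy c K (swap k \<eta>) = energy c K \<eta>
    + 2 * (charge (\<eta> k) - charge (\<eta> (k + 1))) - 2 * cross (\<eta> k) (\<eta> (k + 1))"
proof -
  let ?S = "{c + 1..c + int K}" and ?t = "Transposition.transpose k (k + 1)"
  have p: "?t permutes ?S" using k by (intro permutes_swap_id) auto
  have rem: "(\<Sum>j \<in> ?S. f j) = f k + f (k + 1) + (\<Sum>j \<in> ?S - {k} - {k + 1}. f j)"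
    for f :: "int \<Rightarrow> int"
  proof -
    have "(\<Sum>j \<in> ?S. f j) = f k + (\<Sum>j \<in> ?S - {k}. f j)"
      using k by (intro sum.remove) auto
    also have "(\<Sum>j \<in> ?S - {k}. f j) = f (k + 1) + (\<Sum>j \<in> ?S - {k} - {k + 1}. f j)"
      using k by (intro sum.remove) auto
    finally show ?thesis by simp
  qed
  have "(\<Sum>j \<in> ?S - {k} - {k + 1}. (2 * j - 1) * charge (swap k \<eta> j))
      = (\<Sum>j \<in> ?S - {k} - {k + 1}. (2 * j - 1) * charge (\<eta> j))"
    by (rule sum.cong) (auto simp: swap_def)
  then have "(\<Sum>j \<in> ?S. (2 * j - 1) * charge (swap k \<eta> j))
      = (\<Sum>j \<in> ?S. (2 * j - 1) * charge (\<eta> j)) + 2 * (charge (\<eta> k) - charge (\<eta> (k + 1)))"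
    unfolding rem by (simp add: swap_def algebra_simps)
  moreover have "cross (\<eta> (k + 1)) (\<eta> k) = - cross (\<eta> k) (\<eta> (k + 1))"
    by (auto simp: cross_def)
  moreover have "c + 1 \<le> k" "k + 1 \<le> c + int K"
    using k by auto
  ultimately show ?thesis
    unfolding energy_def sum.distrib
    using pair_sum_adjacent_transpose[of "c + 1" k "c + int K" cross \<eta>] by linarith
qed

lemma swap_swap [simp]: "swap k (swap k \<eta>) = \<eta>"
  by (auto simp: swap_def fun_eq_iff)

lemma configs_values: "\<eta> \<in> configs L \<Longrightarrow> k \<in> sites L \<Longrightarrow> \<eta> k \<in> {0, 1, 2}"
  unfolding configs_def by (rule PiE_mem)

text \<open>In each of the nine cases for the two states, the exponent changes by 2 when the move has rate
  \<open>r\<close>, by -2 when it has rate \<open>l\<close>, and both sides vanish when the two states agree.\<close>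

lemma bond_detailed_balance:
  assumes "0 < r" "0 < l" and q: "q = sqrt (r / l)"
    and k: "k \<in> bonds L" and \<eta>: "\<eta> \<in> configs L"
  shows "weight L q \<eta> * bond_rate r l k \<eta>
    = weight L q (swap k \<eta>) * bond_rate r l k (swap k \<eta>)"
proof -
  have q0: "q > 0" and q2: "q ^ 2 * l = r"
    using assms by auto
  then have m2: "q powi (-2) * r = l"
    by (auto simp: power_int_minus)
  have "k \<in> sites L" "k + 1 \<in> sites L"
    using k by (auto simp: sites_def bonds_def)
  then have vals: "\<eta> k \<in> {0, 1, 2}" "\<eta> (k + 1) \<in> {0, 1, 2}"
    using \<eta> configs_values by blast+
  define e where "e = 2 * (charge (\<eta> k) - charge (\<eta> (k + 1))) - 2 * cross (\<eta> k) (\<eta> (k + 1))"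
  have "energy (- int L) (2 * L) (swap k \<eta>) = energy (- int L) (2 * L) \<eta> + e"
    using energy_swap[of k "- int L" "2 * L" \<eta>] k by (auto simp: bonds_def e_def)
  then have w: "weight L q (swap k \<eta>) = weight L q \<eta> * q powi e"
    unfolding weight_eq_energy using q0 by (simp add: power_int_add)
  have sw: "swap k \<eta> k = \<eta> (k + 1)" "swap k \<eta> (k + 1) = \<eta> k"
    by (auto simp: swap_def)
  have "bond_rate r l k \<eta> = q powi e * bond_rate r l k (swap k \<eta>)"
    using vals q2 m2
    by (elim insertE emptyE)
      (simp_all add: e_def bond_rate_def occ_A_def occ_B_def occ_V_def sw charge_def cross_def)
  then show ?thesis unfolding w by simp
qed

lemma weight_pos: "0 < q \<Longrightarrow> 0 < weight L q \<eta>"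
  by (simp add: weight_def)

lemma reversible_weight:
  assumes "0 < r" "0 < l" and q: "q = sqrt (r / l)"
  shows "reversible L r l (weight L q)"
proof -
  have "q > 0" using assms by simp
  have "weight L q \<eta> * trans_rate L r l \<eta> \<eta>' = weight L q \<eta>' * trans_rate L r l \<eta>' \<eta>"
    if \<eta>: "\<eta> \<in> configs L" for \<eta> \<eta>'
    unfolding trans_rate_def sum_distrib_left
  proof (rule sum.cong)
    fix k assume "k \<in> bonds L"
    then show "weight L q \<eta> * (bond_rate r l k \<eta> * of_bool (\<eta>' = swap k \<eta>))
        = weight L q \<eta>' * (bond_rate r l k \<eta>' * of_bool (\<eta> = swap k \<eta>'))"
      using bond_detailed_balance[OF assms _ \<eta>, of k] by (cases "\<eta>' = swap k \<eta>") auto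
  qed simp
  then show ?thesis
    using weight_pos[OF \<open>q > 0\<close>] unfolding reversible_def by (auto intro: less_imp_le)
qed


section \<open>The Dirichlet form\<close>

text \<open>Interchanging a bond is an involution of \<open>S\<close> that preserves the flow \<open>w \<eta> * bond_rate r l k \<eta>\<close>;
  averaging the sum over \<open>\<eta>\<close> with its reindexed version symmetrises it.\<close>

lemma sum_gen_eq_Dirichlet_form:
  assumes closed: "\<And>k \<eta>. k \<in> bonds L \<Longrightarrow> \<eta> \<in> S \<Longrightarrow> swap k \<eta> \<in> S"
    and balance: "\<And>k \<eta>. k \<in> bonds L \<Longrightarrow> \<eta> \<in> S \<Longrightarrow>
      w \<eta> * bond_rate r l k \<eta> = w (swap k \<eta>) * bond_rate r l k (swap k \<eta>)"
  shows "2 * (\<Sum>\<eta> \<in> S. w \<eta> * f \<eta> * gen L r l g \<eta>)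
    = - (\<Sum>k \<in> bonds L. \<Sum>\<eta> \<in> S. w \<eta> * bond_rate r l k \<eta>
          * ((f (swap k \<eta>) - f \<eta>) * (g (swap k \<eta>) - g \<eta>)))"
proof -
  define T where "T k = (\<Sum>\<eta> \<in> S. w \<eta> * bond_rate r l k \<eta> * (f \<eta> * (g (swap k \<eta>) - g \<eta>)))" for k
  have "(\<Sum>\<eta> \<in> S. w \<eta> * f \<eta> * gen L r l g \<eta>) = (\<Sum>k \<in> bonds L. T k)"
    unfolding T_def gen_def sum_distrib_left
    by (subst sum.swap) (simp add: mult_ac)
  moreover have "2 * T k = - (\<Sum>\<eta> \<in> S. w \<eta> * bond_rate r l k \<eta>
          * ((f (swap k \<eta>) - f \<eta>) * (g (swap k \<eta>) - g \<eta>)))" if k: "k \<in> bonds L" for k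
  proof -
    have "T k = (\<Sum>\<eta> \<in> S. w \<eta> * bond_rate r l k \<eta> * (f (swap k \<eta>) * (g \<eta> - g (swap k \<eta>))))"
      unfolding T_def
      by (rule sum.reindex_bij_witness[of _ "swap k" "swap k"])
        (simp_all add: closed[OF k] balance[OF k, symmetric])
    then have "2 * T k = T k
        + (\<Sum>\<eta> \<in> S. w \<eta> * bond_rate r l k \<eta> * (f (swap k \<eta>) * (g \<eta> - g (swap k \<eta>))))"
      by simp
    also have "\<dots> = - (\<Sum>\<eta> \<in> S. w \<eta> * bond_rate r l k \<eta>
          * ((f (swap k \<eta>) - f \<eta>) * (g (swap k \<eta>) - g \<eta>)))"
      unfolding T_def sum.distrib[symmetric] sum_negf[symmetric]
      by (rule sum.cong) (auto simp: algebra_simps)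
    finally show ?thesis .
  qed
  ultimately show ?thesis
    by (simp add: sum_distrib_left sum_negf)
qed

lemma bond_rate_nonneg: "0 < r \<Longrightarrow> 0 < l \<Longrightarrow> 0 \<le> bond_rate r l k \<eta>"
  by (simp add: bond_rate_def occ_A_def occ_B_def occ_V_def)

lemma swap_eq_or_bond_rate_pos:
  assumes "0 < r" "0 < l" "k \<in> bonds L" "\<eta> \<in> configs L"
  shows "swap k \<eta> = \<eta> \<or> 0 < bond_rate r l k \<eta>"
proof (cases "\<eta> k = \<eta> (k + 1)")
  case True
  then have "swap k \<eta> = \<eta>"
    by (auto simp: swap_def fun_eq_iff Transposition.transpose_def)
  then show ?thesis ..
next
  case False
  have "k \<in> sites L" "k + 1 \<in> sites L"
    using assms(3) by (auto simp: sites_def bonds_def)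
  then have "\<eta> k \<in> {0, 1, 2}" "\<eta> (k + 1) \<in> {0, 1, 2}"
    using assms(4) configs_values by blast+
  with False have "0 < bond_rate r l k \<eta>"
    using assms(1,2) by (auto simp: bond_rate_def occ_A_def occ_B_def occ_V_def)
  then show ?thesis ..
qed


section \<open>Adjacent interchanges connect configurations with equal particle numbers\<close>

text \<open>A long-range transposition is a shorter one conjugated by an adjacent one:
  \<open>(a, b + 1) = (b, b + 1) (a, b) (b, b + 1)\<close>.\<close>

lemma transpose_invariant_if_adjacent:
  assumes closed: "\<And>k \<eta>. k \<in> bonds L \<Longrightarrow> \<eta> \<in> S \<Longrightarrow> swap k \<eta> \<in> S"
    and inv: "\<And>k \<eta>. k \<in> bonds L \<Longrightarrow> \<eta> \<in> S \<Longrightarrow> h (swap k \<eta>) = h \<eta>"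
    and a: "- int L + 1 \<le> a" and ab: "a < b"
  shows "b \<le> int L \<longrightarrow> (\<forall>\<eta> \<in> S. \<eta> \<circ> Transposition.transpose a b \<in> S \<and>
     h (\<eta> \<circ> Transposition.transpose a b) = h \<eta>)"
  using ab
proof (induction b rule: int_gr_induct)
  case base
  show ?case
  proof (intro impI)
    assume "a + 1 \<le> int L"
    with a have "a \<in> bonds L" by (simp add: bonds_def)
    then show "\<forall>\<eta> \<in> S. \<eta> \<circ> Transposition.transpose a (a + 1) \<in> S \<and>
     h (\<eta> \<circ> Transposition.transpose a (a + 1)) = h \<eta>"
      using closed inv by (auto simp: swap_def)
  qed
next
  case (step b)
  show ?case
  proof (intro impI ballI)
    fix \<eta> assume le: "b + 1 \<le> int L" and \<eta>: "\<eta> \<in> S"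
    have b: "b \<in> bonds L" using le step.hyps a by (simp add: bonds_def)
    let ?s = "swap b \<eta> \<circ> Transposition.transpose a b"
    have "b \<le> int L" using le by simp
    then have IH: "?s \<in> S" "h ?s = h (swap b \<eta>)"
      using step.IH closed[OF b \<eta>] by blast+
    have "Transposition.transpose a (b + 1) = Transposition.transpose b (b + 1)
        \<circ> Transposition.transpose a b \<circ> Transposition.transpose b (b + 1)"
      using Transposition.transpose_comp_triple[of "b + 1" a b] step.hyps
      by (simp add: transpose_commute)
    then have "\<eta> \<circ> Transposition.transpose a (b + 1) = swap b ?s"
      by (simp add: swap_def comp_assoc)
    then show "\<eta> \<circ> Transposition.transpose a (b + 1) \<in> S \<and>
        h (\<eta> \<circ> Transposition.transpose a (b + 1)) = h \<eta>"
      using IH closed[OF b IH(1)] inv[OF b IH(1)] inv[OF b \<eta>] by simp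
  qed
qed

lemma permutation_invariant_if_adjacent:
  assumes closed: "\<And>k \<eta>. k \<in> bonds L \<Longrightarrow> \<eta> \<in> S \<Longrightarrow> swap k \<eta> \<in> S"
    and inv: "\<And>k \<eta>. k \<in> bonds L \<Longrightarrow> \<eta> \<in> S \<Longrightarrow> h (swap k \<eta>) = h \<eta>"
    and p: "p permutes sites L" and \<eta>: "\<eta> \<in> S"
  shows "\<eta> \<circ> p \<in> S \<and> h (\<eta> \<circ> p) = h \<eta>"
proof -
  have tr: "\<zeta> \<circ> Transposition.transpose a b \<in> S \<and> h (\<zeta> \<circ> Transposition.transpose a b) = h \<zeta>"
    if "a \<in> sites L" "b \<in> sites L" "a \<noteq> b" "\<zeta> \<in> S" for a b \<zeta>
  proof (cases "a < b")
    case True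
    show ?thesis
      using transpose_invariant_if_adjacent[of L S h a b, OF closed inv] True that
      by (auto simp: sites_def)
  next
    case False
    show ?thesis
      using transpose_invariant_if_adjacent[of L S h b a, OF closed inv] False that
      by (auto simp: sites_def transpose_commute)
  qed
  have "finite (sites L)" by (simp add: sites_def)
  then show ?thesis
    using p
  proof (induction p rule: permutes_rev_induct)
    case id
    show ?case using \<eta> by simp
  next
    case (swap a b p)
    then show ?case using tr[of a b "\<eta> \<circ> p"] by (metis comp_assoc)
  qed
qed

lemma card_eq_sum_of_bool: "finite A \<Longrightarrow> int (card {k \<in> A. P k}) = (\<Sum>k \<in> A. of_bool (P k))"
  by (simp add: of_bool_def sum.If_cases Int_def)

text \<open>With three local states, the numbers of \<open>A\<close> and \<open>B\<close> particles determine how often each state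
  occurs, and a finite family is determined up to permutation by the multiset of its values.\<close>

lemma configs_NM_permutation:
  assumes \<eta>: "\<eta> \<in> configs_NM L N M" and \<eta>': "\<eta>' \<in> configs_NM L N M"
  obtains p where "p permutes sites L" "\<eta> = \<eta>' \<circ> p"
proof -
  have fin: "finite (sites L)" by (simp add: sites_def)
  have c0: "int (card {k \<in> sites L. \<zeta> k = 0}) = int N"
    and c2: "int (card {k \<in> sites L. \<zeta> k = 2}) = int M" if "\<zeta> \<in> configs_NM L N M" for \<zeta>
    using that unfolding configs_NM_def by (simp_all add: card_eq_sum_of_bool[OF fin] occ_A_def occ_B_def)
  have vals: "\<zeta> k \<in> {0, 1, 2}" if "\<zeta> \<in> configs_NM L N M" "k \<in> sites L" for \<zeta> k
    using that configs_values unfolding configs_NM_def by blast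
  have c1: "card {k \<in> sites L. \<zeta> k = 1} = card (sites L) - N - M" if z: "\<zeta> \<in> configs_NM L N M" for \<zeta>
  proof -
    have "{k \<in> sites L. \<zeta> k = 1} = sites L - {k \<in> sites L. \<zeta> k = 0} - {k \<in> sites L. \<zeta> k = 2}"
      using vals[OF z] by fastforce
    moreover have "{k \<in> sites L. \<zeta> k = 2} \<subseteq> sites L - {k \<in> sites L. \<zeta> k = 0}" by auto
    ultimately show ?thesis
      using c0[OF z] c2[OF z] fin by (simp add: card_Diff_subset)
  qed
  have c: "card {k \<in> sites L. \<eta> k = v} = card {k \<in> sites L. \<eta>' k = v}" for v
  proof (cases "v \<in> {0, 1, 2}")
    case True
    then show ?thesis using c0[OF \<eta>] c0[OF \<eta>'] c1[OF \<eta>] c1[OF \<eta>'] c2[OF \<eta>] c2[OF \<eta>'] by auto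
  next
    case False
    then have "{k \<in> sites L. \<eta> k = v} = {}" "{k \<in> sites L. \<eta>' k = v} = {}"
      using vals[OF \<eta>] vals[OF \<eta>'] by blast+
    then show ?thesis by (simp only:)
  qed
  have "image_mset \<eta> (mset_set (sites L)) = image_mset \<eta>' (mset_set (sites L))"
    by (rule multiset_eqI) (simp add: count_image_mset_eq_card_vimage[OF fin] c)
  then obtain p where p: "p permutes sites L" and eq: "\<forall>k \<in> sites L. \<eta> k = \<eta>' (p k)"
    using image_mset_eq_implies_permutes[OF fin] by blast
  have "\<eta> k = \<eta>' (p k)" for k
  proof (cases "k \<in> sites L")
    case False
    \<comment> \<open>Off the lattice both configurations take the value \<open>undefined\<close>.\<close>
    then show ?thesis
      using \<eta> \<eta>' permutes_not_in[OF p False] PiE_arb unfolding configs_NM_def configs_def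
      by fastforce
  qed (use eq in blast)
  then show thesis using p that by (simp add: fun_eq_iff)
qed


section \<open>Invariance under the semigroup and the generator\<close>

lemma power_series_constant_imp_linear_coeff_zero:
  fixes c :: "nat \<Rightarrow> real"
  assumes summ: "\<And>t. summable (\<lambda>n. c n * t ^ n)"
    and const: "\<And>t. 0 \<le> t \<Longrightarrow> (\<Sum>n. c n * t ^ n) = c 0"
  shows "c 1 = 0"
  \<comment> \<open>Constancy is known for nonnegative times only, so the derivative at 0 is taken from the right.\<close>
proof -
  let ?F = "\<lambda>t. \<Sum>n. c n * t ^ n"
  have "(?F has_field_derivative (\<Sum>n. diffs c n * 0 ^ n)) (at 0)"
    using summ by (rule termdiffs_strong_converges_everywhere)
  then have "(?F has_field_derivative c 1) (at 0)"
    by (simp add: diffs_def)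
  then have "(?F has_field_derivative c 1) (at_right 0)"
    by (rule has_field_derivative_at_within)
  then have "((\<lambda>t. (?F t - ?F 0) / (t - 0)) \<longlongrightarrow> c 1) (at_right 0)"
    unfolding has_field_derivative_iff .
  moreover have "((\<lambda>t. (?F t - ?F 0) / (t - 0)) \<longlongrightarrow> 0) (at_right 0)"
    by (rule tendsto_eventually) (auto simp: eventually_at_filter const)
  ultimately show ?thesis
    using tendsto_unique trivial_limit_at_right_real by blast
qed

text \<open>The mean of \<open>semigroup L r l t f\<close> is a power series in \<open>t\<close> whose linear coefficient is the mean of
  \<open>gen f\<close>. It is constant if this mean vanishes for all \<open>f\<close>, since every later coefficient is again
  a mean of some \<open>gen g\<close>.\<close>

lemma invariant_pmf_on_iff_gen:
  assumes S: "S \<subseteq> configs L" and supp: "set_pmf \<mu> \<subseteq> S"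
  shows "invariant_pmf_on L r l S \<mu> \<longleftrightarrow> (\<forall>f. (\<Sum>\<eta> \<in> S. pmf \<mu> \<eta> * gen L r l f \<eta>) = 0)"
proof -
  have fin: "finite S" using S finite_configs finite_subset by blast
  have expect: "measure_pmf.expectation \<mu> f = (\<Sum>\<eta> \<in> S. pmf \<mu> \<eta> * f \<eta>)" for f
    using supp by (subst integral_measure_pmf_real[OF fin]) (auto simp: mult.commute)
  define c where "c f n = (\<Sum>\<eta> \<in> S. pmf \<mu> \<eta> * (gen L r l ^^ n) f \<eta>) / fact n" for f n
  have coeff_term: "c f n * t ^ n = (\<Sum>\<eta> \<in> S. pmf \<mu> \<eta> * (t ^ n / fact n * (gen L r l ^^ n) f \<eta>))" for f n t
    unfolding c_def by (simp add: sum_distrib_left sum_distrib_right sum_divide_distrib mult_ac)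
  have term_summable: "summable (\<lambda>n. pmf \<mu> \<eta> * (t ^ n / fact n * (gen L r l ^^ n) f \<eta>))"
    if "\<eta> \<in> S" for t f \<eta>
    using that S summable_semigroup by (intro summable_mult) blast
  have summ: "summable (\<lambda>n. c f n * t ^ n)" for f t
    unfolding coeff_term by (intro summable_sum term_summable)
  have series: "measure_pmf.expectation \<mu> (semigroup L r l t f) = (\<Sum>n. c f n * t ^ n)" for f t
  proof -
    have "pmf \<mu> \<eta> * (\<Sum>n. t ^ n / fact n * (gen L r l ^^ n) f \<eta>)
        = (\<Sum>n. pmf \<mu> \<eta> * (t ^ n / fact n * (gen L r l ^^ n) f \<eta>))" if "\<eta> \<in> S" for \<eta>
      using that S by (intro suminf_mult[symmetric] summable_semigroup) blast
    then have "measure_pmf.expectation \<mu> (semigroup L r l t f)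
        = (\<Sum>\<eta> \<in> S. \<Sum>n. pmf \<mu> \<eta> * (t ^ n / fact n * (gen L r l ^^ n) f \<eta>))"
      unfolding expect semigroup_def by (rule sum.cong[OF refl])
    also have "\<dots> = (\<Sum>n. c f n * t ^ n)"
      unfolding coeff_term by (rule suminf_sum[symmetric]) (rule term_summable)
    finally show ?thesis .
  qed
  have c0: "c f 0 = measure_pmf.expectation \<mu> f" for f
    unfolding c_def expect by simp
  show ?thesis
  proof
    assume "invariant_pmf_on L r l S \<mu>"
    then have "(\<Sum>n. c f n * t ^ n) = c f 0" if "0 \<le> t" for f t
      using that unfolding invariant_pmf_on_def series c0 by blast
    then have "c f 1 = 0" for f
      using power_series_constant_imp_linear_coeff_zero[of "c f"] summ by blast
    then show "\<forall>f. (\<Sum>\<eta> \<in> S. pmf \<mu> \<eta> * gen L r l f \<eta>) = 0"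
      by (simp add: c_def)
  next
    assume *: "\<forall>f. (\<Sum>\<eta> \<in> S. pmf \<mu> \<eta> * gen L r l f \<eta>) = 0"
    have "c f n = 0" if "n \<noteq> 0" for f n
      using that * by (cases n) (auto simp: c_def)
    then have "(\<Sum>n. c f n * t ^ n) = c f 0" for f t
      using suminf_finite[of "{0}" "\<lambda>n. c f n * t ^ n"] by simp
    then show "invariant_pmf_on L r l S \<mu>"
      unfolding invariant_pmf_on_def series c0 using supp by blast
  qed
qed


section \<open>The partition function\<close>

definition count_state :: "int set \<Rightarrow> nat \<Rightarrow> config \<Rightarrow> int" where
  "count_state A v \<eta> = (\<Sum>k \<in> A. of_bool (\<eta> k = v))"

text \<open>The particle numbers are integers so that removing a particle from an empty species is
  meaningful: the sum is then 0, and the recursion below needs no case distinction.\<close>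

definition partition_sum :: "real \<Rightarrow> int \<Rightarrow> nat \<Rightarrow> int \<Rightarrow> int \<Rightarrow> real" where
  "partition_sum q c K n m = (\<Sum>\<eta> \<in> Pi\<^sub>E {c + 1..c + int K} (\<lambda>_. {0, 1, 2}).
     of_bool (count_state {c + 1..c + int K} 0 \<eta> = n \<and> count_state {c + 1..c + int K} 2 \<eta> = m)
       * q powi energy c K \<eta>)"

lemma norm_factor_eq_partition_sum:
  "norm_factor L q N M = partition_sum q (- int L) (2 * L) (int N) (int M)"
proof -
  have eq: "configs_NM L N M = {\<eta> \<in> configs L.
      count_state (sites L) 0 \<eta> = int N \<and> count_state (sites L) 2 \<eta> = int M}"
    by (simp add: configs_NM_def count_state_def occ_A_def occ_B_def)
  show ?thesis
    unfolding norm_factor_def eq partition_sum_def sites_eq_segment[symmetric]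
      configs_def[symmetric] weight_eq_energy[symmetric]
    by (subst sum.inter_filter[OF finite_configs]) (rule sum.cong, simp_all)
qed

lemma sum_PiE_insert:
  assumes "x \<notin> A"
  shows "(\<Sum>\<eta> \<in> Pi\<^sub>E (insert x A) T. f \<eta>) = (\<Sum>y \<in> T x. \<Sum>\<eta> \<in> Pi\<^sub>E A T. f (\<eta>(x := y)))"
  unfolding PiE_insert_eq
  by (subst sum.reindex[OF inj_combinator[OF assms]]) (simp add: sum.cartesian_product split_def o_def)

lemma count_state_nonneg: "0 \<le> count_state A v \<eta>"
  by (simp add: count_state_def sum_nonneg)

lemma count_state_add_le:
  assumes "finite A"
  shows "count_state A 0 \<eta> + count_state A 2 \<eta> \<le> int (card A)"
proof -
  have "count_state A 0 \<eta> + count_state A 2 \<eta> = (\<Sum>k \<in> A. of_bool (\<eta> k = 0) + of_bool (\<eta> k = 2))"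
    by (simp add: count_state_def sum.distrib)
  also have "\<dots> \<le> (\<Sum>k \<in> A. 1)"
    by (rule sum_mono) auto
  finally show ?thesis by simp
qed

lemma partition_sum_eq_0:
  assumes "n < 0 \<or> m < 0 \<or> int K < n + m"
  shows "partition_sum q c K n m = 0"
  unfolding partition_sum_def
proof (rule sum.neutral, rule ballI)
  fix \<eta> :: config
  let ?A = "{c + 1..c + int K}"
  have "\<not> (count_state ?A 0 \<eta> = n \<and> count_state ?A 2 \<eta> = m)"
    using assms count_state_nonneg[of ?A 0 \<eta>] count_state_nonneg[of ?A 2 \<eta>]
      count_state_add_le[of ?A \<eta>] by auto
  then show "of_bool (count_state ?A 0 \<eta> = n \<and> count_state ?A 2 \<eta> = m) * q powi energy c K \<eta> = 0"
    by simp
qed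

text \<open>The three terms correspond to the state of the added site \<open>c + K + 1\<close>. An \<open>A\<close> there contributes
  \<open>e\<close> to the linear part and \<open>-1\<close> for each of the \<open>m\<close> particles of type \<open>B\<close> to its left; a \<open>B\<close>
  contributes \<open>-e\<close>, and \<open>1\<close> for each of the \<open>n\<close> particles of type \<open>A\<close> to its left.\<close>

lemma partition_sum_Suc:
  fixes c :: int and K :: nat
  assumes q: "0 < q"
  defines "e \<equiv> 2 * c + 2 * int K + 1"
  shows "partition_sum q c (Suc K) n m
    = q powi (e - m) * partition_sum q c K (n - 1) m + partition_sum q c K n m
      + q powi (n - e) * partition_sum q c K n (m - 1)"
proof -
  define x where "x = c + int K + 1"
  let ?A = "{c + 1..c + int K}"
  have e: "e = 2 * x - 1" by (simp add: x_def e_def)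
  have A: "{c + 1..c + int (Suc K)} = insert x ?A" and xA: "x \<notin> ?A"
    by (auto simp: x_def)
  have cs: "count_state (insert x ?A) v (\<eta>(x := y)) = of_bool (y = v) + count_state ?A v \<eta>" for v y \<eta>
  proof -
    have "count_state ?A v (\<eta>(x := y)) = count_state ?A v \<eta>"
      unfolding count_state_def by (rule sum.cong) (use xA in auto)
    then show ?thesis
      using xA unfolding count_state_def by (subst sum.insert) auto
  qed
  have en: "energy c (Suc K) (\<eta>(x := y)) = energy c K \<eta> + e * charge y
      + of_bool (y = 2) * count_state ?A 0 \<eta> - of_bool (y = 0) * count_state ?A 2 \<eta>" for y \<eta>
  proof -
    let ?\<zeta> = "\<eta>(x := y)"
    have x: "{c + 1..<x} = ?A" by (auto simp: x_def)
    have "energy c (Suc K) ?\<zeta> = (2 * x - 1) * charge y + (\<Sum>m \<in> ?A. cross (?\<zeta> m) y)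
       + (\<Sum>j \<in> ?A. (2 * j - 1) * charge (?\<zeta> j) + (\<Sum>m \<in> {c + 1..<j}. cross (?\<zeta> m) (?\<zeta> j)))"
      using xA unfolding energy_def A by (simp add: x)
    also have "(\<Sum>m \<in> ?A. cross (?\<zeta> m) y) = (\<Sum>m \<in> ?A. cross (\<eta> m) y)"
      using xA by (intro sum.cong) auto
    also have "\<dots> = of_bool (y = 2) * count_state ?A 0 \<eta> - of_bool (y = 0) * count_state ?A 2 \<eta>"
      unfolding count_state_def sum_distrib_left sum_subtractf[symmetric]
      by (rule sum.cong) (auto simp: cross_def)
    also have "(\<Sum>j \<in> ?A. (2 * j - 1) * charge (?\<zeta> j) + (\<Sum>m \<in> {c + 1..<j}. cross (?\<zeta> m) (?\<zeta> j)))
        = energy c K \<eta>"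
      unfolding energy_def
    proof (rule sum.cong)
      fix j assume j: "j \<in> ?A"
      have "(\<Sum>m \<in> {c + 1..<j}. cross (?\<zeta> m) (?\<zeta> j)) = (\<Sum>m \<in> {c + 1..<j}. cross (\<eta> m) (\<eta> j))"
        by (rule sum.cong) (use j in \<open>auto simp: x_def\<close>)
      then show "(2 * j - 1) * charge (?\<zeta> j) + (\<Sum>m \<in> {c + 1..<j}. cross (?\<zeta> m) (?\<zeta> j))
          = (2 * j - 1) * charge (\<eta> j) + (\<Sum>m \<in> {c + 1..<j}. cross (\<eta> m) (\<eta> j))"
        using j xA by auto
    qed simp
    finally show ?thesis unfolding e by linarith
  qed
  have pa: "q powi (a + b) = q powi a * q powi b" for a b
    using q by (simp add: power_int_add)
  show ?thesis
    unfolding partition_sum_def A sum_PiE_insert[OF xA] cs en sum_distrib_left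
    by (simp add: sum_distrib_left charge_def)
      (intro arg_cong2[where f = "(+)"] sum.cong refl;
       auto simp: pa[symmetric] algebra_simps)
qed

lemma q_fact_Suc: "q_fact q (Suc n) = q_fact q n * q_num q (real (Suc n))"
  by (simp add: q_fact_def)

lemma q_num_0: "q_num q 0 = 0"
  by (simp add: q_num_def)

lemma q_num_pos:
  assumes q: "0 < q" and x: "0 < x"
  shows "0 < q_num q x"
proof -
  consider "q = 1" | "1 < q" | "q < 1" by linarith
  then show ?thesis
  proof cases
    case 2
    have "q powr (- x) < q powr x" using 2 x by simp
    moreover have "inverse q < q" using 2 inverse_less_1_iff[of q] by linarith
    ultimately show ?thesis using 2 by (simp add: q_num_def)
  next
    case 3
    have "q powr x < q powr (- x)" using 3 q x by (simp add: powr_less_mono')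
    moreover have "q < inverse q" using 3 q one_less_inverse[of q] by linarith
    ultimately show ?thesis using 3 by (simp add: q_num_def divide_neg_neg)
  qed (use x in \<open>simp add: q_num_def\<close>)
qed

lemma q_fact_pos: "0 < q \<Longrightarrow> 0 < q_fact q n"
  by (auto simp: q_fact_def intro!: prod_pos q_num_pos)

text \<open>After multiplication by \<open>q - inverse q\<close> the left-hand side telescopes to
  \<open>q powi (2 * x + z) - q powi (- 2 * y - z)\<close>.\<close>

lemma q_num_add3:
  assumes q: "0 < q"
  shows "q powi (x + z) * q_num q (of_int x) + q_num q (of_int z)
      + q powi (- y - z) * q_num q (of_int y)
    = q powi (x - y) * q_num q (of_int (x + y + z))"
proof (cases "q = 1")
  case True
  then show ?thesis by (simp add: q_num_def)
next
  case False
  define d where "d = q - inverse q"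
  have num: "q_num q (of_int u) = (q powi u - q powi (- u)) / d" for u
    using powr_real_of_int'[of q u] powr_real_of_int'[of q "- u"] q False
    by (simp add: q_num_def d_def)
  have "q powi (x + z) * (q powi x - q powi (- x)) + (q powi z - q powi (- z))
      + q powi (- y - z) * (q powi y - q powi (- y))
    = q powi (x - y) * (q powi (x + y + z) - q powi (- (x + y + z)))"
    using q by (simp add: power_int_add power_int_diff power_int_minus field_simps)
  then show ?thesis
    unfolding num by (simp only: times_divide_eq_right add_divide_distrib[symmetric])
qed

text \<open>The power of \<open>q\<close> comes from the mean \<open>2 * c + K\<close> of \<open>2 * k - 1\<close> over the segment: shifting the
  segment shifts all linear coefficients by a constant. Clearing denominators makes the boundary
  cases uniform. If a species (or the vacancies) is absent, removing one of it gives an empty sum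
  on one side and the factor \<open>q_num q 0 = 0\<close> on the other.\<close>

lemma partition_sum_closed_form:
  assumes q: "0 < q"
  shows "K = N + M + P \<Longrightarrow> partition_sum q c K (int N) (int M) * (q_fact q N * q_fact q M * q_fact q P)
    = q powi ((2 * c + int K) * (int N - int M)) * q_fact q K"
proof (induction K arbitrary: N M P)
  case 0
  then show ?case
    by (simp add: partition_sum_def count_state_def energy_def q_fact_def)
next
  case (Suc K)
  let ?F = "q_fact q N * q_fact q M * q_fact q P"
  let ?s = "2 * c + int K"
  define e where "e = 2 * c + 2 * int K + 1"
  have A: "partition_sum q c K (int N - 1) (int M) * ?F
      = q_num q (real N) * (q powi (?s * (int N - 1 - int M)) * q_fact q K)"
  proof (cases N)
    case 0
    then show ?thesis by (simp add: partition_sum_eq_0 q_num_0)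
  next
    case (Suc N')
    then show ?thesis using Suc.IH[of N' M P] Suc.prems by (simp add: q_fact_Suc mult_ac)
  qed
  have V: "partition_sum q c K (int N) (int M) * ?F
      = q_num q (real P) * (q powi (?s * (int N - int M)) * q_fact q K)"
  proof (cases P)
    case 0
    then show ?thesis using Suc.prems by (simp add: partition_sum_eq_0 q_num_0)
  next
    case (Suc P')
    then show ?thesis using Suc.IH[of N M P'] Suc.prems by (simp add: q_fact_Suc mult_ac)
  qed
  have B: "partition_sum q c K (int N) (int M - 1) * ?F
      = q_num q (real M) * (q powi (?s * (int N - (int M - 1))) * q_fact q K)"
  proof (cases M)
    case 0
    then show ?thesis by (simp add: partition_sum_eq_0 q_num_0)
  next
    case (Suc M')
    then show ?thesis using Suc.IH[of N M' P] Suc.prems by (simp add: q_fact_Suc mult_ac)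
  qed
  have K: "int K = int N + int M + int P - 1" using Suc.prems by simp
  have "partition_sum q c (Suc K) (int N) (int M) * ?F
      = q powi (e - int M) * (partition_sum q c K (int N - 1) (int M) * ?F)
        + partition_sum q c K (int N) (int M) * ?F
        + q powi (int N - e) * (partition_sum q c K (int N) (int M - 1) * ?F)"
    unfolding partition_sum_Suc[OF q] e_def by (simp add: algebra_simps)
  also have "\<dots> = q powi (?s * (int N - int M)) * q_fact q K *
      (q powi (int N + int P) * q_num q (real N) + q_num q (real P)
        + q powi (- int M - int P) * q_num q (real M))"
  proof -
    \<comment> \<open>All three exponents have the part \<open>?s * (int N - int M)\<close> in common.\<close>
    have 1: "e - int M + ?s * (int N - 1 - int M) = ?s * (int N - int M) + (int N + int P)"
      and 2: "int N - e + ?s * (int N - (int M - 1)) = ?s * (int N - int M) + (- int M - int P)"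
      using K by (simp_all add: e_def algebra_simps)
    have sp: "q powi (a + b) = q powi a * q powi b" for a b
      using q by (simp add: power_int_add)
    define W where "W = q powi (?s * (int N - int M))"
    have m1: "q powi (e - int M) * (q_num q (real N) * (q powi (?s * (int N - 1 - int M)) * q_fact q K))
      = W * q powi (int N + int P) * q_num q (real N) * q_fact q K"
      unfolding W_def sp[symmetric] 1[symmetric] unfolding sp by (simp add: mult_ac)
    have m2: "q powi (int N - e) * (q_num q (real M) * (q powi (?s * (int N - (int M - 1))) * q_fact q K))
      = W * q powi (- int M - int P) * q_num q (real M) * q_fact q K"
      unfolding W_def sp[symmetric] 2[symmetric] unfolding sp by (simp add: mult_ac)
    show ?thesis
      unfolding A V B m1 m2 W_def[symmetric] by (simp only: distrib_left distrib_right mult_ac)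
  qed
  also have "q powi (int N + int P) * q_num q (real N) + q_num q (real P)
        + q powi (- int M - int P) * q_num q (real M)
      = q powi (int N - int M) * q_num q (real (Suc K))"
    using q_num_add3[OF q, of "int N" "int P" "int M"] Suc.prems by (simp add: add_ac)
  also have "q powi (?s * (int N - int M)) * q_fact q K * (q powi (int N - int M) * q_num q (real (Suc K)))
      = q powi (?s * (int N - int M) + (int N - int M)) * q_fact q (Suc K)"
    using q by (simp add: power_int_add q_fact_Suc mult_ac)
  also have "?s * (int N - int M) + (int N - int M) = (2 * c + int (Suc K)) * (int N - int M)"
    by (simp add: algebra_simps)
  finally show ?case .
qed

lemma norm_factor_eq_q_trinomial:
  assumes q: "0 < q" and "N + M \<le> 2 * L"
  shows "norm_factor L q N M = q_trinomial q (2 * L) N M"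
proof -
  have "norm_factor L q N M * (q_fact q N * q_fact q M * q_fact q (2 * L - N - M)) = q_fact q (2 * L)"
    using partition_sum_closed_form[OF q, of "2 * L" N M "2 * L - N - M" "- int L"] assms(2)
    by (simp add: norm_factor_eq_partition_sum)
  moreover have "0 < q_fact q N * q_fact q M * q_fact q (2 * L - N - M)"
    using q_fact_pos[OF q] by simp
  ultimately show ?thesis
    unfolding q_trinomial_def by (simp only: eq_divide_eq) auto
qed


section \<open>The invariant measure on a sector\<close>

lemma configs_NM_subset: "configs_NM L N M \<subseteq> configs L"
  by (auto simp: configs_NM_def)

text \<open>The density \<open>h\<close> of \<open>\<mu>\<close> with respect to the weight is itself used as the test function, which
  makes its Dirichlet energy zero.\<close>

lemma invariant_pmf_on_sector_unique:
  assumes "0 < r" "0 < l" and q: "q = sqrt (r / l)"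
    and inv: "invariant_pmf_on L r l (configs_NM L N M) \<mu>"
  shows "pmf \<mu> \<eta> = norm_weight L q N M \<eta>"
proof -
  let ?S = "configs_NM L N M"
  have q0: "q > 0" using assms by simp
  note wpos = weight_pos[OF q0, of L]
  have fin: "finite ?S" by (rule finite_subset[OF configs_NM_subset finite_configs])
  have supp: "set_pmf \<mu> \<subseteq> ?S" using inv by (simp add: invariant_pmf_on_def)
  define h where "h \<zeta> = pmf \<mu> \<zeta> / weight L q \<zeta>" for \<zeta>
  have \<mu>: "pmf \<mu> \<zeta> = weight L q \<zeta> * h \<zeta>" for \<zeta>
    using wpos[of \<zeta>] by (simp add: h_def)
  have balance: "weight L q \<zeta> * bond_rate r l k \<zeta> = weight L q (swap k \<zeta>) * bond_rate r l k (swap k \<zeta>)"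
    if "k \<in> bonds L" "\<zeta> \<in> ?S" for k \<zeta>
    using bond_detailed_balance[OF assms(1-3) that(1)] that(2) configs_NM_subset by blast
  have nonneg: "0 \<le> weight L q \<zeta> * bond_rate r l k \<zeta> * ((h (swap k \<zeta>) - h \<zeta>) * (h (swap k \<zeta>) - h \<zeta>))"
    for k \<zeta>
    using wpos[of \<zeta>] bond_rate_nonneg[OF assms(1,2)] by simp
  have "(\<Sum>\<zeta> \<in> ?S. weight L q \<zeta> * h \<zeta> * gen L r l h \<zeta>) = 0"
    using inv invariant_pmf_on_iff_gen[OF configs_NM_subset supp] unfolding \<mu> by blast
  then have "(\<Sum>k \<in> bonds L. \<Sum>\<zeta> \<in> ?S. weight L q \<zeta> * bond_rate r l k \<zeta>
          * ((h (swap k \<zeta>) - h \<zeta>) * (h (swap k \<zeta>) - h \<zeta>))) = 0"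
    using sum_gen_eq_Dirichlet_form[of L ?S "weight L q" r l h h, OF swap_configs_NM balance] by simp
  then have zero: "weight L q \<zeta> * bond_rate r l k \<zeta> * ((h (swap k \<zeta>) - h \<zeta>) * (h (swap k \<zeta>) - h \<zeta>)) = 0"
    if "k \<in> bonds L" "\<zeta> \<in> ?S" for k \<zeta>
    using that fin nonneg
    by (subst (asm) sum_nonneg_eq_0_iff) (auto simp: bonds_def sum_nonneg sum_nonneg_eq_0_iff)
  have step: "h (swap k \<zeta>) = h \<zeta>" if k: "k \<in> bonds L" and \<zeta>: "\<zeta> \<in> ?S" for k \<zeta>
  proof -
    have "\<zeta> \<in> configs L" using \<zeta> configs_NM_subset by blast
    with swap_eq_or_bond_rate_pos[OF assms(1,2) k] show ?thesis
      using zero[OF k \<zeta>] wpos[of \<zeta>] by fastforce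
  qed
  have const: "h \<zeta> = h \<zeta>'" if \<zeta>: "\<zeta> \<in> ?S" and \<zeta>': "\<zeta>' \<in> ?S" for \<zeta> \<zeta>'
  proof -
    obtain p where "p permutes sites L" "\<zeta> = \<zeta>' \<circ> p"
      using configs_NM_permutation[OF \<zeta> \<zeta>'] by blast
    then show ?thesis
      using permutation_invariant_if_adjacent[of L ?S h p \<zeta>', OF swap_configs_NM step] \<zeta>' by simp
  qed
  show ?thesis
  proof (cases "\<eta> \<in> ?S")
    case True
    have "1 = (\<Sum>\<zeta> \<in> ?S. pmf \<mu> \<zeta>)"
      using sum_pmf_eq_1[OF fin supp] by simp
    also have "\<dots> = (\<Sum>\<zeta> \<in> ?S. h \<eta> * weight L q \<zeta>)"
      by (rule sum.cong) (use const[OF _ True] in \<open>auto simp: \<mu> mult.commute\<close>)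
    also have "\<dots> = h \<eta> * norm_factor L q N M"
      by (simp add: norm_factor_def sum_distrib_left)
    finally have "h \<eta> = 1 / norm_factor L q N M"
      by (metis mult_eq_0_iff nonzero_eq_divide_eq zero_neq_one)
    then show ?thesis using True by (simp add: \<mu> norm_weight_def)
  next
    case False
    then show ?thesis using supp by (auto simp: norm_weight_def set_pmf_iff)
  qed
qed

lemma invariant_pmf_on_sector_exists:
  assumes "0 < r" "0 < l" and q: "q = sqrt (r / l)" and Z: "0 < norm_factor L q N M"
  shows "\<exists>\<mu>. invariant_pmf_on L r l (configs_NM L N M) \<mu>"
proof -
  let ?S = "configs_NM L N M" and ?w = "norm_weight L q N M"
  have q0: "q > 0" using assms by simp
  have fin: "finite ?S" by (rule finite_subset[OF configs_NM_subset finite_configs])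
  have nn: "0 \<le> ?w \<eta>" for \<eta>
    using Z weight_pos[OF q0, of L \<eta>] by (simp add: norm_weight_def indicator_def)
  have out: "?w \<eta> = 0" if "\<eta> \<notin> ?S" for \<eta>
    using that by (simp add: norm_weight_def)
  have in_S: "?w \<eta> = weight L q \<eta> / norm_factor L q N M" if "\<eta> \<in> ?S" for \<eta>
    using that by (simp add: norm_weight_def)
  have "(\<Sum>\<eta> \<in> ?S. ?w \<eta>) = 1"
    using Z by (simp add: in_S sum_divide_distrib[symmetric] norm_factor_def)
  moreover have "(\<integral>\<^sup>+\<eta>. ennreal (?w \<eta>) \<partial>count_space UNIV) = (\<Sum>\<eta> \<in> ?S. ennreal (?w \<eta>))"
    by (rule nn_integral_count_space'[OF fin]) (auto simp: out)
  ultimately have prob: "(\<integral>\<^sup>+\<eta>. ennreal (?w \<eta>) \<partial>count_space UNIV) = 1"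
    by (simp add: sum_ennreal nn)
  define \<mu> where "\<mu> = embed_pmf ?w"
  have \<mu>: "pmf \<mu> \<eta> = ?w \<eta>" for \<eta>
    unfolding \<mu>_def using nn prob by (rule pmf_embed_pmf)
  have supp: "set_pmf \<mu> \<subseteq> ?S"
    unfolding set_pmf_iff \<mu> subset_iff using out by blast
  have "(\<Sum>\<eta> \<in> ?S. weight L q \<eta> * gen L r l f \<eta>) = 0" for f
    using sum_gen_eq_Dirichlet_form[of L ?S "weight L q" r l "\<lambda>_. 1" f, OF swap_configs_NM]
      bond_detailed_balance[OF assms(1-3)] configs_NM_subset by (simp add: subset_iff)
  then have "(\<Sum>\<eta> \<in> ?S. pmf \<mu> \<eta> * gen L r l f \<eta>) = 0" for f
    by (simp add: \<mu> in_S sum_divide_distrib[symmetric])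
  then show ?thesis
    using invariant_pmf_on_iff_gen[OF configs_NM_subset supp] by blast
qed

theorem theorem3p1:
  fixes L :: nat and r l q :: real
  assumes "1 \<le> L" and "0 < r" and "0 < l" and "q = sqrt (r / l)"
  shows "reversible L r l (weight L q) \<and>
    (\<forall>N M :: nat. N + M \<le> 2 * L \<longrightarrow>
       (\<exists>!\<mu>. invariant_pmf_on L r l (configs_NM L N M) \<mu>) \<and>
       (\<forall>\<mu>. invariant_pmf_on L r l (configs_NM L N M) \<mu> \<longrightarrow>
            (\<forall>\<eta>. pmf \<mu> \<eta> = norm_weight L q N M \<eta>)) \<and>
       norm_factor L q N M = q_trinomial q (2 * L) N M)"
proof (intro conjI allI impI)
  have q0: "0 < q" using assms by simp
  show "reversible L r l (weight L q)"
    using assms by (intro reversible_weight)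
  fix N M assume NM: "N + M \<le> 2 * L"
  show Z: "norm_factor L q N M = q_trinomial q (2 * L) N M"
    using q0 NM by (rule norm_factor_eq_q_trinomial)
  show unique: "pmf \<mu> \<eta> = norm_weight L q N M \<eta>"
    if "invariant_pmf_on L r l (configs_NM L N M) \<mu>" for \<mu> \<eta>
    using assms(2-4) that by (rule invariant_pmf_on_sector_unique)
  have "0 < norm_factor L q N M"
    unfolding Z q_trinomial_def using q_fact_pos[OF q0] by simp
  then obtain \<mu> where "invariant_pmf_on L r l (configs_NM L N M) \<mu>"
    using invariant_pmf_on_sector_exists[OF assms(2-4)] by blast
  then show "\<exists>!\<mu>. invariant_pmf_on L r l (configs_NM L N M) \<mu>"
    using unique by (metis pmf_eqI)
qed

end
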